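(* Let $X$ be a Lévy process with $X_0=0$ that drifts to $-\infty$ and is such that $\mathbb{E}[\theta]<\infty$. The time $\tau=0$ is optimal in $$V(y)=\inf_\tau\mathbb{E}\left[\int_0^\tau(2F(Y^y_t)-1)\,\mathrm{d}t\right]$$ for all $y\ge0$ if and only if $\mathrm{m}=0$. In this case $V(y)=0$ for all $y\ge0$.
   Context: $X=(X_t)_{t\ge0}$ is a real-valued Lévy process starting from $0$ on a filtered probability space $(\Omega,\mathcal{F},\mathbf{F},\mathbb{P})$, where $\mathbf{F}$ is the naturally enlarged filtration generated by $X$. "$X$ drifts to $-\infty$" means $\lim_{t\to\infty}X_t=-\infty$ a.s. Write $\overline{X}_t=\sup_{0\le s\le t}X_s$, $\overline{X}_\infty=\lim_{t\to\infty}\overline{X}_t$, and $\theta=\inf\{t\ge0\mid\overline{X}_t=\overline{X}_\infty\}$ (with $\inf\emptyset=\infty$). $F$ is the distribution function of $\overline{X}_\infty$, and $\mathrm{m}=\inf\{z\ge0\mid F(z)\ge1/2\}$ is its (lower) median. For $y\ge0$, $Y^y_t=(y\vee\overline{X}_t)-X_t$, $t\ge0$. The infimum in $V(y)$ is over $\mathbf{F}$-stopping times; a stopping time is optimal in $V(y)$ if it attains the infimum. *)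

theory Defs
  imports "HOL-Probability.Probability"
begin

locale levy_process = prob_space M for M :: "'a measure" +
  fixes X :: "real \<Rightarrow> 'a \<Rightarrow> real"
  assumes random_variable: "\<And>t. 0 \<le> t \<Longrightarrow> X t \<in> borel_measurable M"
    and starts_at_0: "AE \<omega> in M. X 0 \<omega> = 0"
    and independent_increments:
      "\<And>(t :: nat \<Rightarrow> real) n. 0 \<le> t 0 \<Longrightarrow> (\<And>i. i < n \<Longrightarrow> t i \<le> t (Suc i)) \<Longrightarrow>
         indep_vars (\<lambda>_. borel) (\<lambda>i \<omega>. X (t (Suc i)) \<omega> - X (t i) \<omega>) {..<n}"
    and stationary_increments:
      "\<And>s t. 0 \<le> s \<Longrightarrow> s \<le> t \<Longrightarrow>
         distr M borel (\<lambda>\<omega>. X t \<omega> - X s \<omega>) = distr M borel (X (t - s))"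
    and cadlag:
      "AE \<omega> in M. (\<forall>t\<ge>0. continuous (at_right t) (\<lambda>s. X s \<omega>)) \<and>
                  (\<forall>t>0. \<exists>l. ((\<lambda>s. X s \<omega>) \<longlongrightarrow> l) (at_left t))"

definition drifts_to_minus_infinity :: "'a measure \<Rightarrow> (real \<Rightarrow> 'a \<Rightarrow> real) \<Rightarrow> bool" where
  "drifts_to_minus_infinity M X \<longleftrightarrow> (AE \<omega> in M. filterlim (\<lambda>t. X t \<omega>) at_bot at_top)"

text \<open>The time index is \<^typ>\<open>ennreal\<close> so that stopping times may take the value infinity.\<close>

definition generated_filtration ::
    "'a measure \<Rightarrow> (real \<Rightarrow> 'a \<Rightarrow> real) \<Rightarrow> ennreal \<Rightarrow> 'a measure" where
  "generated_filtration M X t =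
     sigma (space M) (\<Union>s\<in>{s. 0 \<le> s \<and> ennreal s \<le> t}. {X s -` A \<inter> space M |A. A \<in> sets borel})"

text \<open>The natural enlargement in the sense of Bichteler (Stochastic Integration with Jumps,
  Section 1.3): adjoin to each sigma-algebra all subsets of countable unions of null events that
  are each observable in finite time, and pass to the right-continuous version.\<close>

definition nearly_empty :: "'a measure \<Rightarrow> (real \<Rightarrow> 'a \<Rightarrow> real) \<Rightarrow> 'a set \<Rightarrow> bool" where
  "nearly_empty M X A \<longleftrightarrow>
     (\<exists>B :: nat \<Rightarrow> 'a set.
        (\<forall>n. \<exists>t<\<top>. B n \<in> sets (generated_filtration M X t) \<inter> null_sets M) \<and> A \<subseteq> (\<Union>n. B n))"

text \<open>Inserting \<^term>\<open>\<top> :: ennreal\<close> changes nothing at finite times; it only prevents an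
  intersection over the empty index set at time infinity.\<close>

definition natural_enlargement ::
    "'a measure \<Rightarrow> (real \<Rightarrow> 'a \<Rightarrow> real) \<Rightarrow> ennreal \<Rightarrow> 'a measure" where
  "natural_enlargement M X t =
     sigma (space M) (\<Inter>u\<in>insert \<top> {t<..}.
       sigma_sets (space M) (sets (generated_filtration M X u) \<union> {A. nearly_empty M X A}))"

text \<open>The paths of a Levy process drifting to minus infinity are almost surely bounded above, so
  the real-valued supremum and limit below are almost surely the true ones. Since path properties
  hold only up to null sets, laws and expectations of path functionals are taken with respect to
  the completion of the underlying measure.\<close>

definition running_sup :: "(real \<Rightarrow> 'a \<Rightarrow> real) \<Rightarrow> real \<Rightarrow> 'a \<Rightarrow> real" where
  "running_sup X t \<omega> = (SUP s\<in>{0..t}. X s \<omega>)"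

definition total_sup :: "(real \<Rightarrow> 'a \<Rightarrow> real) \<Rightarrow> 'a \<Rightarrow> real" where
  "total_sup X \<omega> = Lim at_top (\<lambda>t. running_sup X t \<omega>)"

definition sup_time :: "(real \<Rightarrow> 'a \<Rightarrow> real) \<Rightarrow> 'a \<Rightarrow> ennreal" where
  "sup_time X \<omega> = (INF t\<in>{t. 0 \<le> t \<and> running_sup X t \<omega> = total_sup X \<omega>}. ennreal t)"

definition sup_cdf :: "'a measure \<Rightarrow> (real \<Rightarrow> 'a \<Rightarrow> real) \<Rightarrow> real \<Rightarrow> real" where
  "sup_cdf M X = cdf (distr (completion M) borel (total_sup X))"

definition sup_median :: "'a measure \<Rightarrow> (real \<Rightarrow> 'a \<Rightarrow> real) \<Rightarrow> real" where
  "sup_median M X = Inf {z. 0 \<le> z \<and> sup_cdf M X z \<ge> 1 / 2}"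

definition reflected :: "(real \<Rightarrow> 'a \<Rightarrow> real) \<Rightarrow> real \<Rightarrow> real \<Rightarrow> 'a \<Rightarrow> real" where
  "reflected X y t \<omega> = max y (running_sup X t \<omega>) - X t \<omega>"

text \<open>Integral with values in the extended reals, for functions whose negative part has finite
  integral; \<^const>\<open>e2ennreal\<close> sends negative numbers to 0.\<close>

definition extended_integral :: "'b measure \<Rightarrow> ('b \<Rightarrow> ereal) \<Rightarrow> ereal" where
  "extended_integral N f =
     enn2ereal (\<integral>\<^sup>+x. e2ennreal (f x) \<partial>N) - enn2ereal (\<integral>\<^sup>+x. e2ennreal (- f x) \<partial>N)"

definition expected_cost ::
    "'a measure \<Rightarrow> (real \<Rightarrow> 'a \<Rightarrow> real) \<Rightarrow> real \<Rightarrow> ('a \<Rightarrow> ennreal) \<Rightarrow> ereal" where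
  "expected_cost M X y \<tau> =
     extended_integral (completion M) (\<lambda>\<omega>.
       extended_integral lborel (\<lambda>t.
         ereal (indicator {t. 0 \<le> t \<and> ennreal t \<le> \<tau> \<omega>} t *
                (2 * sup_cdf M X (reflected X y t \<omega>) - 1))))"

definition optimal_value :: "'a measure \<Rightarrow> (real \<Rightarrow> 'a \<Rightarrow> real) \<Rightarrow> real \<Rightarrow> ereal" where
  "optimal_value M X y =
     (INF \<tau>\<in>{\<tau>. stopping_time (natural_enlargement M X) \<tau>}. expected_cost M X y \<tau>)"

definition optimal ::
    "'a measure \<Rightarrow> (real \<Rightarrow> 'a \<Rightarrow> real) \<Rightarrow> real \<Rightarrow> ('a \<Rightarrow> ennreal) \<Rightarrow> bool" where
  "optimal M X y \<tau> \<longleftrightarrow>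
     stopping_time (natural_enlargement M X) \<tau> \<and> expected_cost M X y \<tau> = optimal_value M X y"

end

theory Submission imports Defs begin

text \<open>
  Write \<open>F\<close> for the distribution function of the total supremum and \<open>m\<close> for its median.
  Stopping at once costs \<open>0\<close>, so everything depends on the sign of the running cost
  \<open>2 F(Y) - 1\<close> along the reflected path \<open>Y\<close>, which almost surely stays in \<open>[0, \<infinity>)\<close>.

  If \<open>m = 0\<close>, right-continuity of \<open>F\<close> gives \<open>F(0) \<ge> 1/2\<close>, so the running cost is never negative
  and no stopping time can do better than \<open>0\<close> (\<open>expected_cost_nonneg\<close>).

  If \<open>m > 0\<close>, then \<open>F(m/2) < 1/2\<close>. Started from \<open>y = 0\<close>, the reflected path starts at \<open>0\<close> and is
  right-continuous there, so with probability close to one it stays below \<open>m/2\<close> up to a small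
  deterministic time \<open>\<delta>\<close>. On that event the cost accumulated up to \<open>\<delta>\<close> is at most
  \<open>-\<delta> (1 - 2 F(m/2))\<close>, and on its complement it is at most \<open>\<delta>\<close>. Hence the constant stopping
  time \<open>\<delta>\<close> has negative expected cost and beats \<open>0\<close> (\<open>ex_negative_expected_cost\<close>).

  Using a constant time instead of the first exit time from \<open>[0, m/2]\<close> makes the stopping property
  immediate and leaves only events involving countably many times to be measured. Both estimates
  compare integrands pointwise, by monotonicity of \<^const>\<open>extended_integral\<close> on arbitrary functions
  (\<open>extended_integral_mono_AE\<close>). That \<open>F\<close> is a genuine distribution function rests on the
  measurability of the total supremum (\<open>total_sup_measurable\<close>), which holds because almost every
  path is bounded above and determined by its values at rational times.
\<close>

section \<open>The extended integral\<close>

text \<open>The nonnegative integral is a supremum over simple functions below the integrand, and so is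
  monotone even where the integrand is not measurable.\<close>

lemma extended_integral_mono_AE:
  assumes "AE x in N. f x \<le> g x"
  shows "extended_integral N f \<le> extended_integral N g"
proof -
  have "(\<integral>\<^sup>+x. e2ennreal (f x) \<partial>N) \<le> (\<integral>\<^sup>+x. e2ennreal (g x) \<partial>N)"
    using assms by (intro nn_integral_mono_AE) (auto intro: e2ennreal_mono)
  moreover have "(\<integral>\<^sup>+x. e2ennreal (- g x) \<partial>N) \<le> (\<integral>\<^sup>+x. e2ennreal (- f x) \<partial>N)"
    using assms by (intro nn_integral_mono_AE) (auto intro!: e2ennreal_mono)
  ultimately show ?thesis
    unfolding extended_integral_def
    by (intro ereal_minus_mono) (simp_all add: less_eq_ennreal.rep_eq)
qed

lemma extended_integral_cong_AE:
  assumes "AE x in N. f x = g x"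
  shows "extended_integral N f = extended_integral N g"
  using assms by (intro antisym extended_integral_mono_AE) (auto elim: eventually_mono)

lemma extended_integral_eq_integral:
  fixes g :: "'b \<Rightarrow> real"
  assumes "integrable N g"
  shows "extended_integral N (\<lambda>x. ereal (g x)) = ereal (\<integral>x. g x \<partial>N)"
proof -
  have "(\<integral>\<^sup>+x. ennreal (g x) \<partial>N) < \<infinity>" "(\<integral>\<^sup>+x. ennreal (- g x) \<partial>N) < \<infinity>"
    using assms unfolding real_integrable_def by (auto simp: less_top)
  then obtain a b where "0 \<le> a" "(\<integral>\<^sup>+x. ennreal (g x) \<partial>N) = ennreal a"
      "0 \<le> b" "(\<integral>\<^sup>+x. ennreal (- g x) \<partial>N) = ennreal b"
    by (metis ennreal_cases infinity_ennreal_def less_irrefl)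
  then show ?thesis
    using real_lebesgue_integral_def[OF assms]
    by (simp add: extended_integral_def)
qed

lemma extended_integral_0: "extended_integral N (\<lambda>_. 0) = 0"
  using extended_integral_eq_integral[of N "\<lambda>_. 0"] by (simp add: zero_ereal_def)

lemma extended_integral_nonneg:
  assumes "AE x in N. 0 \<le> f x"
  shows "0 \<le> extended_integral N f"
  using extended_integral_mono_AE[of "\<lambda>_. 0" f N] assms by (simp add: extended_integral_0)

section \<open>Right-continuous paths\<close>

text \<open>Transfers bounds from countably many times to all times. The time \<open>t\<close> itself may be
  irrational, so the bound has to come from rationals strictly to its right.\<close>

lemma right_continuous_le_of_rationals:
  fixes f :: "real \<Rightarrow> real"
  assumes "continuous (at_right t) f" "t < b"
    and le: "\<And>q. q \<in> \<rat> \<Longrightarrow> t < q \<Longrightarrow> q < b \<Longrightarrow> f q \<le> c"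
  shows "f t \<le> c"
proof (rule ccontr)
  assume "\<not> f t \<le> c"
  moreover have "(f \<longlongrightarrow> f t) (at_right t)"
    using assms(1) by (simp add: continuous_within)
  ultimately have "\<forall>\<^sub>F s in at_right t. c < f s"
    by (intro order_tendstoD(1)) auto
  then obtain d where d: "t < d" "\<And>s. t < s \<Longrightarrow> s < d \<Longrightarrow> c < f s"
    unfolding eventually_at_right_field by auto
  obtain q where "q \<in> \<rat>" "t < q" "q < min b d"
    using Rats_dense_in_real[of t "min b d"] d(1) \<open>t < b\<close> by auto
  then show False
    using le[of q] d(2)[of q] by auto
qed

lemma tendsto_imp_locally_bounded_above:
  fixes f :: "real \<Rightarrow> real"
  assumes "(f \<longlongrightarrow> l) F"
  shows "\<exists>C. \<forall>\<^sub>F s in F. f s \<le> C"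
  using order_tendstoD(2)[OF assms, of "l + 1"] by (auto elim!: eventually_mono intro!: exI[of _ "l + 1"])

text \<open>One-sided limits bound the path near every point, and bisection glues the local bounds
  together. The sets are intersected with \<open>{0..}\<close> because the bisection principle also asks for
  intervals that extend to the left of the point \<open>0\<close>, where nothing is known about the path.\<close>

lemma cadlag_bdd_above_on_compact:
  fixes f :: "real \<Rightarrow> real"
  assumes rc: "\<And>t. 0 \<le> t \<Longrightarrow> continuous (at_right t) f"
    and ll: "\<And>t. 0 < t \<Longrightarrow> \<exists>l. (f \<longlongrightarrow> l) (at_left t)"
  shows "bdd_above (f ` {0..T})"
proof (cases "0 \<le> T")
  case True
  have "bdd_above (f ` ({0..T} \<inter> {0..}))"
    using True
  proof (induction rule: Bolzano[where P = "\<lambda>a b. bdd_above (f ` ({a..b} \<inter> {0..}))"])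
    case (trans a b c)
    then have "{a..c} \<inter> {0..} = ({a..b} \<inter> {0..}) \<union> ({b..c} \<inter> {0..})" by auto
    then have "f ` ({a..c} \<inter> {0..}) = f ` ({a..b} \<inter> {0..}) \<union> f ` ({b..c} \<inter> {0..})"
      by (simp only: image_Un)
    then show ?case using trans by (simp only: bdd_above_Un)
  next
    case (local x)
    have "(f \<longlongrightarrow> f x) (at_right x)"
      using rc[of x] local by (simp add: continuous_within)
    then obtain C where "\<forall>\<^sub>F s in at_right x. f s \<le> C"
      using tendsto_imp_locally_bounded_above by blast
    then obtain u where u: "x < u" "\<And>s. x < s \<Longrightarrow> s < u \<Longrightarrow> f s \<le> C"
      unfolding eventually_at_right_field by auto
    obtain v D where v: "v < x" "\<And>s. 0 \<le> s \<Longrightarrow> v < s \<Longrightarrow> s < x \<Longrightarrow> f s \<le> D"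
    proof (cases "x = 0")
      case True
      then show ?thesis using that[of "-1" 0] by auto
    next
      case False
      then obtain l where "(f \<longlongrightarrow> l) (at_left x)"
        using ll[of x] local by auto
      then obtain D where "\<forall>\<^sub>F s in at_left x. f s \<le> D"
        using tendsto_imp_locally_bounded_above by blast
      then show ?thesis
        unfolding eventually_at_left_field using that by blast
    qed
    have "bdd_above (f ` ({a..b} \<inter> {0..}))"
      if ab: "a \<le> x \<and> x \<le> b \<and> b - a < min (u - x) (x - v)" for a b
    proof (rule bdd_aboveI2)
      fix s assume "s \<in> {a..b} \<inter> {0..}"
      then show "f s \<le> max (f x) (max C D)"
        using ab u(2)[of s] v(2)[of s] by (cases s x rule: linorder_cases) auto
    qed
    then show ?case
      using u(1) v(1) by (intro exI[of _ "min (u - x) (x - v)"]) auto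
  qed
  then show ?thesis
    using True by (simp add: Int_absorb2)
qed simp

text \<open>Without this bound the real-valued suprema in \<^const>\<open>running_sup\<close> and \<^const>\<open>total_sup\<close> would
  be arbitrary values.\<close>

lemma cadlag_at_bot_bdd_above:
  fixes f :: "real \<Rightarrow> real"
  assumes "\<And>t. 0 \<le> t \<Longrightarrow> continuous (at_right t) f"
    and "\<And>t. 0 < t \<Longrightarrow> \<exists>l. (f \<longlongrightarrow> l) (at_left t)"
    and "filterlim f at_bot at_top"
  shows "bdd_above (f ` {0..})"
proof -
  obtain T where T: "\<And>t. T \<le> t \<Longrightarrow> f t \<le> 0"
    using assms(3) unfolding filterlim_at_bot eventually_at_top_linorder by blast
  have "bdd_above (f ` {T..})"
    using T by (intro bdd_aboveI2[of _ _ 0]) auto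
  then have "bdd_above (f ` ({0..T} \<union> {T..}))"
    using cadlag_bdd_above_on_compact[of f T] assms by (simp add: image_Un)
  then show ?thesis
    by (rule bdd_above_mono) auto
qed

text \<open>Expresses the total supremum through countably many random variables. The supremum is taken
  in the extended reals because there it is measurable without any bound on the exceptional paths.\<close>

lemma total_sup_eq_rational_SUP:
  assumes bdd: "bdd_above ((\<lambda>t. X t \<omega>) ` {0..})"
    and rc: "\<And>t. 0 \<le> t \<Longrightarrow> continuous (at_right t) (\<lambda>s. X s \<omega>)"
  shows "total_sup X \<omega> = real_of_ereal (SUP q\<in>\<rat> \<inter> {0..}. ereal (X q \<omega>))"
proof -
  define S where "S = (SUP q\<in>\<rat> \<inter> {0..}. X q \<omega>)"
  have bddQ: "bdd_above ((\<lambda>t. X t \<omega>) ` (\<rat> \<inter> {0..}))"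
    using bdd by (rule bdd_above_mono) auto
  have ne: "\<rat> \<inter> {0::real..} \<noteq> {}"
    using Rats_0 by force
  have le_S: "X t \<omega> \<le> S" if "0 \<le> t" for t
    using rc[OF that]
  proof (rule right_continuous_le_of_rationals)
    show "t < t + 1" by simp
    show "X q \<omega> \<le> S" if "q \<in> \<rat>" "t < q" for q
      unfolding S_def using that \<open>0 \<le> t\<close> bddQ by (intro cSUP_upper) auto
  qed
  have "((\<lambda>t. running_sup X t \<omega>) \<longlongrightarrow> S) at_top"
  proof (rule order_tendstoI)
    fix a assume "a < S"
    then obtain q where q: "q \<in> \<rat>" "0 \<le> q" "a < X q \<omega>"
      unfolding S_def using less_cSUP_iff[OF ne bddQ] by auto
    have "a < running_sup X t \<omega>" if "q \<le> t" for t
    proof -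
      have "X q \<omega> \<le> running_sup X t \<omega>"
        unfolding running_sup_def using that q bdd
        by (intro cSUP_upper bdd_above_mono[OF bdd]) auto
      then show ?thesis using q by simp
    qed
    then show "\<forall>\<^sub>F t in at_top. a < running_sup X t \<omega>"
      unfolding eventually_at_top_linorder by blast
  next
    fix a assume "S < a"
    have "running_sup X t \<omega> < a" if "0 \<le> t" for t
    proof -
      have "running_sup X t \<omega> \<le> S"
        unfolding running_sup_def using that le_S by (intro cSUP_least) auto
      then show ?thesis using \<open>S < a\<close> by simp
    qed
    then show "\<forall>\<^sub>F t in at_top. running_sup X t \<omega> < a"
      unfolding eventually_at_top_linorder by blast
  qed
  then have "total_sup X \<omega> = S"
    unfolding total_sup_def by (intro tendsto_Lim) auto
  also have "ereal S = (SUP q\<in>\<rat> \<inter> {0..}. ereal (X q \<omega>))"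
  proof (rule antisym)
    show "(SUP q\<in>\<rat> \<inter> {0..}. ereal (X q \<omega>)) \<le> ereal S"
      using le_S by (intro SUP_least) auto
    show "ereal S \<le> (SUP q\<in>\<rat> \<inter> {0..}. ereal (X q \<omega>))"
    proof (rule ereal_le_real)
      fix z assume z: "(SUP q\<in>\<rat> \<inter> {0..}. ereal (X q \<omega>)) \<le> ereal z"
      have "X q \<omega> \<le> z" if "q \<in> \<rat> \<inter> {0..}" for q
        using z SUP_upper[OF that, of "\<lambda>q. ereal (X q \<omega>)"] by (simp flip: ereal_less_eq(3))
      then show "ereal S \<le> ereal z"
        unfolding S_def ereal_less_eq(3) using ne by (rule cSUP_least[rotated -1])
    qed
  qed
  then have "S = real_of_ereal (SUP q\<in>\<rat> \<inter> {0..}. ereal (X q \<omega>))"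
    by (metis real_of_ereal.simps(1))
  finally show ?thesis .
qed

section \<open>The law of the total supremum\<close>

lemma (in complete_measure) borel_measurable_AE_eq:
  assumes f: "f \<in> borel_measurable M" and eq: "AE x in M. f x = g x"
  shows "g \<in> borel_measurable M"
proof (rule measurableI)
  fix A :: "'b set" assume "A \<in> sets borel"
  then have "f -` A \<inter> space M \<in> sets M"
    using f by (rule measurable_sets[rotated])
  then show "g -` A \<inter> space M \<in> sets M"
    by (rule in_sets_AE[rotated]) (use eq in auto)
qed simp

context
  fixes M :: "'a measure" and X :: "real \<Rightarrow> 'a \<Rightarrow> real"
  assumes levy: "levy_process M X" and drift: "drifts_to_minus_infinity M X"
begin

interpretation levy_process M X by (rule levy)

interpretation C: prob_space "completion M" by (rule prob_space_completion)

lemma AE_path_bdd_above: "AE \<omega> in completion M. bdd_above ((\<lambda>t. X t \<omega>) ` {0..})"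
proof -
  have "AE \<omega> in M. bdd_above ((\<lambda>t. X t \<omega>) ` {0..})"
    using cadlag drift[unfolded drifts_to_minus_infinity_def]
    by eventually_elim (rule cadlag_at_bot_bdd_above, auto)
  then show ?thesis by (rule AE_completion)
qed

lemma AE_path_right_continuous:
  "AE \<omega> in completion M. \<forall>t\<ge>0. continuous (at_right t) (\<lambda>s. X s \<omega>)"
  using AE_completion[OF cadlag] by eventually_elim auto

lemma total_sup_measurable: "total_sup X \<in> borel_measurable (completion M)"
proof (rule completion.borel_measurable_AE_eq)
  show "(\<lambda>\<omega>. real_of_ereal (SUP q\<in>\<rat> \<inter> {0..}. ereal (X q \<omega>))) \<in> borel_measurable (completion M)"
    using random_variable
    by (intro borel_measurable_real_of_ereal borel_measurable_SUP borel_measurable_ereal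
        measurable_completion countable_Int1 countable_rat) auto
  show "AE \<omega> in completion M. real_of_ereal (SUP q\<in>\<rat> \<inter> {0..}. ereal (X q \<omega>)) = total_sup X \<omega>"
    using AE_path_bdd_above AE_path_right_continuous
    by eventually_elim (auto simp: total_sup_eq_rational_SUP)
qed

interpretation D: real_distribution "distr (completion M) borel (total_sup X)"
  by (rule C.real_distribution_distr) (rule total_sup_measurable)

lemma sup_cdf_mono: "x \<le> y \<Longrightarrow> sup_cdf M X x \<le> sup_cdf M X y"
  unfolding sup_cdf_def by (rule D.cdf_nondecreasing)

lemma sup_cdf_le_1: "sup_cdf M X x \<le> 1"
  unfolding sup_cdf_def by (rule D.cdf_bounded_prob)

lemma ex_sup_cdf_ge_half: "{z. 0 \<le> z \<and> sup_cdf M X z \<ge> 1 / 2} \<noteq> {}"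
proof -
  have "\<forall>\<^sub>F z in at_top. 1 / 2 < sup_cdf M X z"
    unfolding sup_cdf_def using D.cdf_lim_at_top_prob by (rule order_tendstoD) simp
  then have "\<forall>\<^sub>F z in at_top. 0 \<le> z \<and> 1 / 2 \<le> sup_cdf M X z"
    using eventually_ge_at_top[of 0] by eventually_elim auto
  then show ?thesis
    by (auto dest: eventually_happens)
qed

lemma sup_median_nonneg: "0 \<le> sup_median M X"
  unfolding sup_median_def by (rule cInf_greatest[OF ex_sup_cdf_ge_half]) auto

lemma sup_cdf_less_half:
  assumes "0 \<le> z" "z < sup_median M X"
  shows "sup_cdf M X z < 1 / 2"
proof (rule ccontr)
  assume "\<not> sup_cdf M X z < 1 / 2"
  then have "sup_median M X \<le> z"
    unfolding sup_median_def using assms(1)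
    by (intro cInf_lower bdd_belowI[of _ 0]) auto
  then show False using assms(2) by simp
qed

text \<open>The infimum defining the median is attained, by right-continuity of the distribution
  function.\<close>

lemma sup_cdf_ge_half_at_median: "1 / 2 \<le> sup_cdf M X (sup_median M X)"
proof (rule ccontr)
  assume less: "\<not> ?thesis"
  moreover have "(sup_cdf M X \<longlongrightarrow> sup_cdf M X (sup_median M X)) (at_right (sup_median M X))"
    unfolding sup_cdf_def using D.cdf_is_right_cont by (simp add: continuous_within)
  ultimately have "\<forall>\<^sub>F z in at_right (sup_median M X). sup_cdf M X z < 1 / 2"
    by (intro order_tendstoD(2)) auto
  then obtain b where b: "sup_median M X < b"
      "\<And>z. sup_median M X < z \<Longrightarrow> z < b \<Longrightarrow> sup_cdf M X z < 1 / 2"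
    unfolding eventually_at_right_field by auto
  obtain z where z: "0 \<le> z" "1 / 2 \<le> sup_cdf M X z" "z < b"
    using cInf_lessD[OF ex_sup_cdf_ge_half, of b] b(1) unfolding sup_median_def by auto
  moreover have "sup_median M X \<le> z"
    using sup_cdf_less_half[of z] z by force
  ultimately show False
    using b(2)[of z] less by (cases "z = sup_median M X") auto
qed

section \<open>Costs of stopping times\<close>

lemma expected_cost_0: "expected_cost M X y (\<lambda>_. 0) = 0"
proof -
  have "extended_integral lborel (\<lambda>t. ereal (indicator {t. 0 \<le> t \<and> ennreal t \<le> 0} t *
            (2 * sup_cdf M X (reflected X y t \<omega>) - 1))) = 0" for \<omega>
  proof -
    have "AE t in lborel. ereal (indicator {t. 0 \<le> t \<and> ennreal t \<le> 0} t *
            (2 * sup_cdf M X (reflected X y t \<omega>) - 1)) = 0"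
      using AE_lborel_singleton[of "0::real"]
      by eventually_elim (simp add: indicator_def zero_ereal_def ennreal_eq_0_iff)
    then show ?thesis
      using extended_integral_cong_AE[of _ "\<lambda>_. 0" lborel] by (simp only: extended_integral_0)
  qed
  then show ?thesis
    by (simp add: expected_cost_def extended_integral_0)
qed

lemma expected_cost_nonneg:
  assumes "sup_median M X = 0"
  shows "0 \<le> expected_cost M X y \<tau>"
  unfolding expected_cost_def
proof (rule extended_integral_nonneg)
  have half: "1 / 2 \<le> sup_cdf M X z" if "0 \<le> z" for z
    using sup_cdf_ge_half_at_median sup_cdf_mono[OF that] assms by simp
  show "AE \<omega> in completion M. 0 \<le> extended_integral lborel (\<lambda>t.
          ereal (indicator {t. 0 \<le> t \<and> ennreal t \<le> \<tau> \<omega>} t *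
            (2 * sup_cdf M X (reflected X y t \<omega>) - 1)))"
    using AE_path_bdd_above
  proof eventually_elim
    case (elim \<omega>)
    have "0 \<le> reflected X y t \<omega>" if "0 \<le> t" for t
    proof -
      have "X t \<omega> \<le> running_sup X t \<omega>"
        unfolding running_sup_def using that
        by (intro cSUP_upper bdd_above_mono[OF elim]) auto
      then show ?thesis by (simp add: reflected_def)
    qed
    then have "0 \<le> 2 * sup_cdf M X (reflected X y t \<omega>) - 1" if "0 \<le> t" for t
      using half[of "reflected X y t \<omega>"] that by simp
    then show ?case
      by (intro extended_integral_nonneg AE_I2) (simp add: indicator_def)
  qed
qed

text \<open>A path is right-continuous at \<open>0\<close> with value \<open>0\<close>, so it is small on some interval
  \<open>[0, 1/n)\<close>; the corresponding events increase to an event of probability one. Only rational times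
  enter the events, which keeps them measurable.\<close>

lemma sup_prob_path_small_near_0:
  assumes "0 < \<epsilon>" "p < 1"
  obtains A r where "A \<in> sets M" "p < prob A" "0 < r"
    "\<And>\<omega> q. \<omega> \<in> A \<Longrightarrow> q \<in> \<rat> \<Longrightarrow> 0 \<le> q \<Longrightarrow> q < r \<Longrightarrow> \<bar>X q \<omega>\<bar> \<le> \<epsilon>"
proof -
  define A where "A n = {\<omega>\<in>space M. \<forall>q\<in>\<rat> \<inter> {0..<1 / real (Suc n)}. \<bar>X q \<omega>\<bar> \<le> \<epsilon>}" for n
  have A_sets: "A n \<in> sets M" for n
    unfolding A_def
  proof (rule sets.sets_Collect_countable_All')
    fix q assume "q \<in> \<rat> \<inter> {0..<1 / real (Suc n)}"
    then have [measurable]: "X q \<in> borel_measurable M" using random_variable by simp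
    show "{\<omega> \<in> space M. \<bar>X q \<omega>\<bar> \<le> \<epsilon>} \<in> sets M" by measurable
  qed (rule countable_Int1, rule countable_rat)
  have "incseq A"
  proof (rule incseq_SucI, unfold A_def, safe)
    fix n \<omega> q
    assume "\<forall>q\<in>\<rat> \<inter> {0..<1 / real (Suc n)}. \<bar>X q \<omega>\<bar> \<le> \<epsilon>" "q \<in> \<rat>"
      "q \<in> {0..<1 / real (Suc (Suc n))}"
    moreover have "1 / real (Suc (Suc n)) \<le> 1 / real (Suc n)" by (simp add: frac_le)
    ultimately show "\<bar>X q \<omega>\<bar> \<le> \<epsilon>" by auto
  qed
  have "AE \<omega> in M. \<omega> \<in> (\<Union>n. A n)"
    using cadlag starts_at_0 AE_space
  proof eventually_elim
    case (elim \<omega>)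
    have "((\<lambda>s. \<bar>X s \<omega>\<bar>) \<longlongrightarrow> 0) (at_right 0)"
      using elim tendsto_rabs_zero[of "\<lambda>s. X s \<omega>" "at_right 0"] by (auto simp: continuous_within)
    then have "\<forall>\<^sub>F s in at_right 0. \<bar>X s \<omega>\<bar> < \<epsilon>"
      using \<open>0 < \<epsilon>\<close> by (rule order_tendstoD(2))
    then obtain b where b: "0 < b" "\<And>s. 0 < s \<Longrightarrow> s < b \<Longrightarrow> \<bar>X s \<omega>\<bar> < \<epsilon>"
      unfolding eventually_at_right_field by auto
    obtain n where n: "1 / real (Suc n) < b"
      using nat_approx_posE[OF b(1)] .
    have "\<bar>X q \<omega>\<bar> \<le> \<epsilon>" if "0 \<le> q" "q < 1 / real (Suc n)" for q
      using b(2)[of q] that n elim \<open>0 < \<epsilon>\<close> by (cases "q = 0") auto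
    then have "\<omega> \<in> A n" using elim by (auto simp: A_def)
    then show ?case by blast
  qed
  then have "prob (\<Union>n. A n) = 1"
    using A_sets by (subst prob_eq_1) auto
  moreover have "(\<lambda>n. prob (A n)) \<longlonglongrightarrow> prob (\<Union>n. A n)"
    using A_sets \<open>incseq A\<close> by (intro finite_Lim_measure_incseq) auto
  ultimately have "\<forall>\<^sub>F n in sequentially. p < prob (A n)"
    using \<open>p < 1\<close> by (intro order_tendstoD(1)) auto
  then obtain n where "p < prob (A n)"
    by (auto simp: eventually_sequentially)
  then show ?thesis
    using A_sets by (intro that[of "A n" "1 / real (Suc n)"]) (auto simp: A_def)
qed

text \<open>With \<open>c = 1 - 2 F(m/2) > 0\<close> and an event \<open>A\<close> of small paths, the cost of stopping at \<open>\<delta>\<close> is at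
  most \<open>\<delta> (1 - P(A)) - c \<delta> P(A)\<close>. This is negative as soon as \<open>P(A) > 1 / (1 + c)\<close>, which is why
  that threshold is requested below.\<close>

lemma ex_negative_expected_cost:
  assumes "0 < sup_median M X"
  obtains \<delta> :: real where "expected_cost M X 0 (\<lambda>_. ennreal \<delta>) < 0"
proof -
  \<comment> \<open>If \<open>\<bar>X\<bar> \<le> \<epsilon>\<close> up to time \<open>t\<close>, the reflected process is at most \<open>2 \<epsilon> = m/2\<close>.\<close>
  define \<epsilon> where "\<epsilon> = sup_median M X / 4"
  define c where "c = 1 - 2 * sup_cdf M X (2 * \<epsilon>)"
  have "0 < \<epsilon>" using assms by (simp add: \<epsilon>_def)
  have "0 < c"
    using sup_cdf_less_half[of "2 * \<epsilon>"] assms by (simp add: c_def \<epsilon>_def)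
  have "1 / (1 + c) < 1" using \<open>0 < c\<close> by simp
  then obtain A r where A: "A \<in> sets M" "1 / (1 + c) < prob A" "0 < r"
      "\<And>\<omega> q. \<omega> \<in> A \<Longrightarrow> q \<in> \<rat> \<Longrightarrow> 0 \<le> q \<Longrightarrow> q < r \<Longrightarrow> \<bar>X q \<omega>\<bar> \<le> \<epsilon>"
    using sup_prob_path_small_near_0[OF \<open>0 < \<epsilon>\<close>] by blast
  \<comment> \<open>Staying strictly below \<open>r\<close> leaves room for rationals to the right of \<open>\<delta>\<close>.\<close>
  define \<delta> where "\<delta> = r / 2"
  have \<delta>: "0 < \<delta>" "\<delta> < r" using A(3) by (auto simp: \<delta>_def)
  have inner: "AE \<omega> in completion M. extended_integral lborel (\<lambda>t.
          ereal (indicator {t. 0 \<le> t \<and> ennreal t \<le> ennreal \<delta>} t *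
            (2 * sup_cdf M X (reflected X 0 t \<omega>) - 1)))
        \<le> ereal (\<delta> * (1 - (1 + c) * indicator A \<omega>))"
    using AE_path_right_continuous
  proof eventually_elim
    case (elim \<omega>)
    \<comment> \<open>The cost rate bound: \<open>-c\<close> on \<open>A\<close> and \<open>1\<close> off \<open>A\<close>.\<close>
    define k where "k = 1 - (1 + c) * indicator A \<omega>"
    have k: "2 * sup_cdf M X (reflected X 0 t \<omega>) - 1 \<le> k" if t: "0 \<le> t" "t \<le> \<delta>" for t
    proof (cases "\<omega> \<in> A")
      case False
      then show ?thesis using sup_cdf_le_1[of "reflected X 0 t \<omega>"] by (simp add: k_def)
    next
      case True
      have small: "X s \<omega> \<le> \<epsilon>" "- X s \<omega> \<le> \<epsilon>" if s: "0 \<le> s" "s \<le> \<delta>" for s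
      proof -
        have cont: "continuous (at_right s) (\<lambda>u. X u \<omega>)" and "s < r"
          using elim s \<delta> by auto
        have q: "\<bar>X q \<omega>\<bar> \<le> \<epsilon>" if "q \<in> \<rat>" "s < q" "q < r" for q
          using A(4)[OF True] that s by auto
        show "X s \<omega> \<le> \<epsilon>"
          by (rule right_continuous_le_of_rationals[OF cont \<open>s < r\<close>]) (use q in force)
        show "- X s \<omega> \<le> \<epsilon>"
          by (rule right_continuous_le_of_rationals[OF continuous_minus[OF cont] \<open>s < r\<close>])
            (use q in force)
      qed
      have "running_sup X t \<omega> \<le> \<epsilon>"
        unfolding running_sup_def using t small by (intro cSUP_least) auto
      then have "reflected X 0 t \<omega> \<le> 2 * \<epsilon>"
        using small(2)[OF t] \<open>0 < \<epsilon>\<close> by (simp add: reflected_def)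
      then show ?thesis
        using sup_cdf_mono True by (fastforce simp: k_def c_def)
    qed
    have "extended_integral lborel (\<lambda>t.
          ereal (indicator {t. 0 \<le> t \<and> ennreal t \<le> ennreal \<delta>} t *
            (2 * sup_cdf M X (reflected X 0 t \<omega>) - 1)))
        \<le> extended_integral lborel (\<lambda>t. ereal (k * indicator {0..\<delta>} t))"
      using k \<delta> by (intro extended_integral_mono_AE AE_I2) (auto simp: indicator_def ennreal_le_iff)
    also have "\<dots> = ereal (k * \<delta>)"
      using \<delta> by (subst extended_integral_eq_integral) auto
    finally show ?case by (simp add: k_def mult.commute)
  qed
  have "expected_cost M X 0 (\<lambda>_. ennreal \<delta>)
      \<le> extended_integral (completion M) (\<lambda>\<omega>. ereal (\<delta> * (1 - (1 + c) * indicator A \<omega>)))"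
    unfolding expected_cost_def using inner by (rule extended_integral_mono_AE)
  also have "\<dots> = ereal (\<delta> * (1 - (1 + c) * prob A))"
    using A(1) C.prob_space by (subst extended_integral_eq_integral) (auto simp: less_top[symmetric])
  also have "\<dots> < 0"
  proof -
    have "1 - (1 + c) * prob A < 0"
      using A(2) \<open>0 < c\<close> by (simp add: field_simps)
    then show ?thesis
      using \<delta>(1) by (simp add: mult_pos_neg)
  qed
  finally show ?thesis by (rule that)
qed

lemma optimal_0_iff_median_0:
  "((\<forall>y\<ge>0. optimal M X y (\<lambda>_. 0)) \<longleftrightarrow> sup_median M X = 0) \<and>
   (sup_median M X = 0 \<longrightarrow> (\<forall>y\<ge>0. optimal_value M X y = 0))"
proof -
  have value_le: "optimal_value M X y \<le> expected_cost M X y (\<lambda>_. t)" for y t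
    unfolding optimal_value_def by (intro INF_lower) (simp add: stopping_time_const)
  have value_0: "optimal_value M X y = 0" if "sup_median M X = 0" for y
  proof (rule antisym)
    show "optimal_value M X y \<le> 0"
      using value_le[of y 0] by (simp add: expected_cost_0)
    show "0 \<le> optimal_value M X y"
      unfolding optimal_value_def by (intro INF_greatest expected_cost_nonneg that)
  qed
  have "sup_median M X = 0" if opt: "optimal M X 0 (\<lambda>_. 0)"
  proof (rule ccontr)
    assume "sup_median M X \<noteq> 0"
    then have "0 < sup_median M X" using sup_median_nonneg by simp
    then obtain \<delta> where "expected_cost M X 0 (\<lambda>_. ennreal \<delta>) < 0"
      by (rule ex_negative_expected_cost)
    then have "optimal_value M X 0 < 0"
      using value_le by (rule le_less_trans[rotated])
    then show False
      using opt by (simp add: optimal_def expected_cost_0)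
  qed
  then show ?thesis
    using value_0 by (auto simp: optimal_def expected_cost_0 stopping_time_const)
qed

end

theorem proposition7:
  fixes M :: "'a measure" and X :: "real \<Rightarrow> 'a \<Rightarrow> real"
  assumes "levy_process M X"
    and "drifts_to_minus_infinity M X"
    and "(\<integral>\<^sup>+\<omega>. sup_time X \<omega> \<partial>completion M) < \<infinity>"
  shows "((\<forall>y\<ge>0. optimal M X y (\<lambda>_. 0)) \<longleftrightarrow> sup_median M X = 0) \<and>
         (sup_median M X = 0 \<longrightarrow> (\<forall>y\<ge>0. optimal_value M X y = 0))"
  using assms(1,2) by (rule optimal_0_iff_median_0)

end
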